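(* Let $(P,\mu,[-,-],\varepsilon,\alpha,\beta)$ be a BiHom-Poisson color algebra and let $\alpha',\beta':P\to P$ be two even morphisms of BiHom-Poisson color algebras such that any two of the maps $\alpha,\alpha',\beta,\beta'$ commute. Define $x\ast y=\mu(\alpha'(x),\beta'(y))$ and $\{x,y\}=[\alpha'(x),\beta'(y)]$ for $x,y\in P$. Then $(P,\ast,\{-,-\},\varepsilon,\alpha\alpha',\beta\beta')$ is a BiHom-Poisson color algebra.
   Context: $\mathbb{K}$ is a field of characteristic different from 2 and $G$ is an abelian group (written additively). A skew-symmetric bicharacter on $G$ is a map $\varepsilon:G\times G\to\mathbb{K}^*$ with $\varepsilon(g,g')\varepsilon(g',g)=1$, $\varepsilon(g,g'+g'')=\varepsilon(g,g')\varepsilon(g,g'')$, $\varepsilon(g+g',g'')=\varepsilon(g,g'')\varepsilon(g',g'')$; $\varepsilon$ denotes such a bicharacter. For homogeneous $x,y$ of degrees $g,g'$ one writes $\varepsilon(x,y)=\varepsilon(g,g')$. A linear map is even if it preserves degrees; a bilinear map $\mu$ is even if $\mu(V_g,V_{g'})\subseteq V_{g+g'}$. A BiHom-Poisson color algebra $(P,\cdot,[-,-],\varepsilon,\alpha,\beta)$ is a $G$-graded $\mathbb{K}$-vector space $P$ with an even bilinear product $\cdot$ (also denoted $\mu$), an even bilinear bracket $[-,-]$, and even linear maps $\alpha,\beta:P\to P$ such that $\alpha\beta=\beta\alpha$, $\alpha$ and $\beta$ are multiplicative for both the product and the bracket, and for all homogeneous $x,y,z$: - $\alpha(x)\cdot(y\cdot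 z)=(x\cdot y)\cdot\beta(z)$; - $[\beta(x),\alpha(y)]=-\varepsilon(x,y)[\beta(y),\alpha(x)]$; - $\oint_{x,y,z}\varepsilon(z,x)[\beta^2(x),[\beta(y),\alpha(z)]]=0$ (cyclic sum over $x,y,z$); - $[\alpha\beta(x),y\cdot z]=[\beta(x),y]\cdot\beta(z)+\varepsilon(x,y)\,\beta(y)\cdot[\alpha(x),z]$. A morphism of BiHom-Poisson color algebras is an even linear map preserving product and bracket and commuting with the structure maps $\alpha$ and $\beta$. *)

theory Defs
  imports Complex_Main
begin

locale skew_bicharacter =
  fixes \<epsilon> :: "'g::ab_group_add \<Rightarrow> 'g \<Rightarrow> 'k::field"
  assumes nonzero: "\<epsilon> g h \<noteq> 0"
    and skew: "\<epsilon> g h * \<epsilon> h g = 1"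
    and add_right: "\<epsilon> g (h + h') = \<epsilon> g h * \<epsilon> g h'"
    and add_left: "\<epsilon> (g + h) h' = \<epsilon> g h' * \<epsilon> h h'"

text \<open>The vector space is the whole type \<open>'p\<close>; \<open>V g\<close> is its homogeneous component of degree \<open>g\<close>.
  The second assumption says that the space is the (internal) direct sum of the components.\<close>

locale graded_vector_space = vector_space scale
  for scale :: "'k::field \<Rightarrow> 'p::ab_group_add \<Rightarrow> 'p" +
  fixes V :: "'g::ab_group_add \<Rightarrow> 'p set"
  assumes component_subspace: "subspace (V g)"
    and unique_decomposition:
      "\<exists>!c. (\<forall>g. c g \<in> V g) \<and> finite {g. c g \<noteq> 0} \<and> x = (\<Sum>g | c g \<noteq> 0. c g)"

definition even_linear ::
    "('k::field \<Rightarrow> 'p::ab_group_add \<Rightarrow> 'p) \<Rightarrow> ('g \<Rightarrow> 'p set) \<Rightarrow>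
     ('k \<Rightarrow> 'q::ab_group_add \<Rightarrow> 'q) \<Rightarrow> ('g \<Rightarrow> 'q set) \<Rightarrow> ('p \<Rightarrow> 'q) \<Rightarrow> bool"
  where "even_linear s1 V s2 W f \<longleftrightarrow>
    Vector_Spaces.linear s1 s2 f \<and> (\<forall>g. \<forall>x\<in>V g. f x \<in> W g)"

definition even_bilinear ::
    "('k::field \<Rightarrow> 'p::ab_group_add \<Rightarrow> 'p) \<Rightarrow> ('g::ab_group_add \<Rightarrow> 'p set) \<Rightarrow>
     ('p \<Rightarrow> 'p \<Rightarrow> 'p) \<Rightarrow> bool"
  where "even_bilinear s V m \<longleftrightarrow>
    (\<forall>x. Vector_Spaces.linear s s (\<lambda>y. m x y)) \<and>
    (\<forall>y. Vector_Spaces.linear s s (\<lambda>x. m x y)) \<and>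
    (\<forall>g h. \<forall>x\<in>V g. \<forall>y\<in>V h. m x y \<in> V (g + h))"

text \<open>The colour factor of homogeneous elements is evaluated at their degrees; each identity is
  required for all choices of degrees (the zero vector has every degree).\<close>

locale bihom_poisson_color_algebra =
  graded_vector_space scale V + skew_bicharacter \<epsilon>
  for scale :: "'k::field \<Rightarrow> 'p::ab_group_add \<Rightarrow> 'p"
    and V :: "'g::ab_group_add \<Rightarrow> 'p set"
    and mult :: "'p \<Rightarrow> 'p \<Rightarrow> 'p"
    and bracket :: "'p \<Rightarrow> 'p \<Rightarrow> 'p"
    and \<epsilon> :: "'g \<Rightarrow> 'g \<Rightarrow> 'k"
    and \<alpha> \<beta> :: "'p \<Rightarrow> 'p" +
  assumes mult_even_bilinear: "even_bilinear scale V mult"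
    and bracket_even_bilinear: "even_bilinear scale V bracket"
    and \<alpha>_even_linear: "even_linear scale V scale V \<alpha>"
    and \<beta>_even_linear: "even_linear scale V scale V \<beta>"
    and \<alpha>_\<beta>_commute: "\<alpha> \<circ> \<beta> = \<beta> \<circ> \<alpha>"
    and \<alpha>_mult: "\<alpha> (mult x y) = mult (\<alpha> x) (\<alpha> y)"
    and \<beta>_mult: "\<beta> (mult x y) = mult (\<beta> x) (\<beta> y)"
    and \<alpha>_bracket: "\<alpha> (bracket x y) = bracket (\<alpha> x) (\<alpha> y)"
    and \<beta>_bracket: "\<beta> (bracket x y) = bracket (\<beta> x) (\<beta> y)"
    and bihom_associative:
      "\<lbrakk>x \<in> V a; y \<in> V b; z \<in> V c\<rbrakk> \<Longrightarrow>
        mult (\<alpha> x) (mult y z) = mult (mult x y) (\<beta> z)"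
    and bihom_skew_symmetric:
      "\<lbrakk>x \<in> V a; y \<in> V b\<rbrakk> \<Longrightarrow>
        bracket (\<beta> x) (\<alpha> y) = - scale (\<epsilon> a b) (bracket (\<beta> y) (\<alpha> x))"
    and bihom_jacobi:
      "\<lbrakk>x \<in> V a; y \<in> V b; z \<in> V c\<rbrakk> \<Longrightarrow>
        scale (\<epsilon> c a) (bracket (\<beta> (\<beta> x)) (bracket (\<beta> y) (\<alpha> z))) +
        scale (\<epsilon> a b) (bracket (\<beta> (\<beta> y)) (bracket (\<beta> z) (\<alpha> x))) +
        scale (\<epsilon> b c) (bracket (\<beta> (\<beta> z)) (bracket (\<beta> x) (\<alpha> y))) = 0"
    and bihom_leibniz:
      "\<lbrakk>x \<in> V a; y \<in> V b; z \<in> V c\<rbrakk> \<Longrightarrow>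
        bracket (\<alpha> (\<beta> x)) (mult y z) =
          mult (bracket (\<beta> x) y) (\<beta> z) +
          scale (\<epsilon> a b) (mult (\<beta> y) (bracket (\<alpha> x) z))"

locale bihom_poisson_color_morphism =
  dom: bihom_poisson_color_algebra s1 V1 mult1 bracket1 \<epsilon> \<alpha>1 \<beta>1 +
  cod: bihom_poisson_color_algebra s2 V2 mult2 bracket2 \<epsilon> \<alpha>2 \<beta>2
  for s1 :: "'k::field \<Rightarrow> 'p::ab_group_add \<Rightarrow> 'p"
    and V1 :: "'g::ab_group_add \<Rightarrow> 'p set"
    and mult1 bracket1 \<alpha>1 \<beta>1
    and s2 :: "'k \<Rightarrow> 'q::ab_group_add \<Rightarrow> 'q"
    and V2 :: "'g \<Rightarrow> 'q set"
    and mult2 bracket2 \<alpha>2 \<beta>2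
    and \<epsilon> :: "'g \<Rightarrow> 'g \<Rightarrow> 'k"
    and f :: "'p \<Rightarrow> 'q" +
  assumes even_linear: "even_linear s1 V1 s2 V2 f"
    and preserves_mult: "f (mult1 x y) = mult2 (f x) (f y)"
    and preserves_bracket: "f (bracket1 x y) = bracket2 (f x) (f y)"
    and commutes_\<alpha>: "f \<circ> \<alpha>1 = \<alpha>2 \<circ> f"
    and commutes_\<beta>: "f \<circ> \<beta>1 = \<beta>2 \<circ> f"

end

theory Submission
  imports Defs
begin

text \<open>
  Since \<open>\<alpha>'\<close> and \<open>\<beta>'\<close> preserve both operations, they can be moved through every product and
  bracket until they act directly on the variables, and since the four maps commute, their powers
  can be collected there in any order. After this, each of the following identities for the twisted
  operations and the structure maps \<open>\<alpha> \<circ> \<alpha>'\<close> and \<open>\<beta> \<circ> \<beta>'\<close> is the same identity for the original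
  algebra, evaluated at the images of \<open>x\<close>, \<open>y\<close>, \<open>z\<close> under words in \<open>\<alpha>'\<close> and \<open>\<beta>'\<close>:

  \<^item> associativity at \<open>\<alpha>' \<alpha>' x\<close>, \<open>\<alpha>' \<beta>' y\<close>, \<open>\<beta>' \<beta>' z\<close>;
  \<^item> the Leibniz rule at \<open>\<alpha>' \<alpha>' \<beta>' x\<close>, \<open>\<alpha>' \<beta>' y\<close>, \<open>\<beta>' \<beta>' z\<close>;
  \<^item> skew-symmetry at \<open>\<alpha>' \<beta>' x\<close>, \<open>\<alpha>' \<beta>' y\<close>;
  \<^item> the Jacobi identity at \<open>\<alpha>' \<beta>' \<beta>' x\<close>, \<open>\<alpha>' \<beta>' \<beta>' y\<close>, \<open>\<alpha>' \<beta>' \<beta>' z\<close>.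

  For skew-symmetry and the Jacobi identity it matters that all variables receive the same word,
  because there the variables are permuted. The words are even maps, so the degrees of the
  variables, and with them all colour factors, are unchanged.
\<close>

lemma even_linear_in_component:
  "even_linear s1 V s2 W f \<Longrightarrow> x \<in> V g \<Longrightarrow> f x \<in> W g"
  by (simp add: even_linear_def)

lemma even_linear_compose:
  assumes "even_linear s1 U s2 V f" and "even_linear s2 V s3 W h"
  shows "even_linear s1 U s3 W (h \<circ> f)"
  using assms by (auto simp: even_linear_def intro: Vector_Spaces.linear_compose)

lemma even_bilinear_twist:
  assumes m: "even_bilinear s V m"
    and f: "even_linear s V s V f" and h: "even_linear s V s V h"
  shows "even_bilinear s V (\<lambda>x y. m (f x) (h y))"
proof -
  have "Vector_Spaces.linear s s (\<lambda>y. m (f x) (h y))" for x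
    using Vector_Spaces.linear_compose[of s s h s "m (f x)"] m h
    by (simp add: even_bilinear_def even_linear_def comp_def)
  moreover have "Vector_Spaces.linear s s (\<lambda>x. m (f x) (h y))" for y
    using Vector_Spaces.linear_compose[of s s f s "\<lambda>x. m x (h y)"] m f
    by (simp add: even_bilinear_def even_linear_def comp_def)
  ultimately show ?thesis
    using m f h by (simp add: even_bilinear_def even_linear_def)
qed

theorem theorem3p1:
  fixes scale :: "'k::field \<Rightarrow> 'p::ab_group_add \<Rightarrow> 'p"
    and V :: "'g::ab_group_add \<Rightarrow> 'p set"
    and mult bracket :: "'p \<Rightarrow> 'p \<Rightarrow> 'p"
    and \<epsilon> :: "'g \<Rightarrow> 'g \<Rightarrow> 'k"
    and \<alpha> \<beta> \<alpha>' \<beta>' :: "'p \<Rightarrow> 'p"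
  assumes "CHAR('k) \<noteq> 2"
    and "bihom_poisson_color_algebra scale V mult bracket \<epsilon> \<alpha> \<beta>"
    and "bihom_poisson_color_morphism
           scale V mult bracket \<alpha> \<beta> scale V mult bracket \<alpha> \<beta> \<epsilon> \<alpha>'"
    and "bihom_poisson_color_morphism
           scale V mult bracket \<alpha> \<beta> scale V mult bracket \<alpha> \<beta> \<epsilon> \<beta>'"
    and "\<forall>f\<in>{\<alpha>, \<alpha>', \<beta>, \<beta>'}. \<forall>h\<in>{\<alpha>, \<alpha>', \<beta>, \<beta>'}. f \<circ> h = h \<circ> f"
  shows "bihom_poisson_color_algebra scale V
           (\<lambda>x y. mult (\<alpha>' x) (\<beta>' y)) (\<lambda>x y. bracket (\<alpha>' x) (\<beta>' y))
           \<epsilon> (\<alpha> \<circ> \<alpha>') (\<beta> \<circ> \<beta>')"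
proof -
  interpret P: bihom_poisson_color_algebra scale V mult bracket \<epsilon> \<alpha> \<beta> by fact
  interpret A: bihom_poisson_color_morphism
    scale V mult bracket \<alpha> \<beta> scale V mult bracket \<alpha> \<beta> \<epsilon> \<alpha>' by fact
  interpret B: bihom_poisson_color_morphism
    scale V mult bracket \<alpha> \<beta> scale V mult bracket \<alpha> \<beta> \<epsilon> \<beta>' by fact
  have commute: "f (h x) = h (f x)" if "f \<in> {\<alpha>, \<alpha>', \<beta>, \<beta>'}" "h \<in> {\<alpha>, \<alpha>', \<beta>, \<beta>'}" for f h x
    using assms(5) that by (metis comp_apply)
  \<comment> \<open>Oriented as rewrite rules, these sort every word into the order \<open>\<alpha> \<beta> \<alpha>' \<beta>'\<close>.\<close>
  have sort_words:
    "\<beta> (\<alpha> x) = \<alpha> (\<beta> x)" "\<alpha>' (\<alpha> x) = \<alpha> (\<alpha>' x)" "\<alpha>' (\<beta> x) = \<beta> (\<alpha>' x)"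
    "\<beta>' (\<alpha> x) = \<alpha> (\<beta>' x)" "\<beta>' (\<beta> x) = \<beta> (\<beta>' x)" "\<beta>' (\<alpha>' x) = \<alpha>' (\<beta>' x)" for x
    by (rule commute; simp)+
  note distribute = P.\<alpha>_mult P.\<beta>_mult P.\<alpha>_bracket P.\<beta>_bracket
    A.preserves_mult A.preserves_bracket B.preserves_mult B.preserves_bracket
  note degree = even_linear_in_component[OF A.even_linear]
    even_linear_in_component[OF B.even_linear]
  show ?thesis
  proof
    show "even_bilinear scale V (\<lambda>x y. mult (\<alpha>' x) (\<beta>' y))"
      by (rule even_bilinear_twist[OF P.mult_even_bilinear A.even_linear B.even_linear])
    show "even_bilinear scale V (\<lambda>x y. bracket (\<alpha>' x) (\<beta>' y))"
      by (rule even_bilinear_twist[OF P.bracket_even_bilinear A.even_linear B.even_linear])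
    show "even_linear scale V scale V (\<alpha> \<circ> \<alpha>')"
      by (rule even_linear_compose[OF A.even_linear P.\<alpha>_even_linear])
    show "even_linear scale V scale V (\<beta> \<circ> \<beta>')"
      by (rule even_linear_compose[OF B.even_linear P.\<beta>_even_linear])
    show "(\<alpha> \<circ> \<alpha>') \<circ> (\<beta> \<circ> \<beta>') = (\<beta> \<circ> \<beta>') \<circ> (\<alpha> \<circ> \<alpha>')"
      by (simp add: fun_eq_iff sort_words)
  next
    fix x y
    show "(\<alpha> \<circ> \<alpha>') (mult (\<alpha>' x) (\<beta>' y)) = mult (\<alpha>' ((\<alpha> \<circ> \<alpha>') x)) (\<beta>' ((\<alpha> \<circ> \<alpha>') y))"
      and "(\<beta> \<circ> \<beta>') (mult (\<alpha>' x) (\<beta>' y)) = mult (\<alpha>' ((\<beta> \<circ> \<beta>') x)) (\<beta>' ((\<beta> \<circ> \<beta>') y))"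
      and "(\<alpha> \<circ> \<alpha>') (bracket (\<alpha>' x) (\<beta>' y)) =
        bracket (\<alpha>' ((\<alpha> \<circ> \<alpha>') x)) (\<beta>' ((\<alpha> \<circ> \<alpha>') y))"
      and "(\<beta> \<circ> \<beta>') (bracket (\<alpha>' x) (\<beta>' y)) =
        bracket (\<alpha>' ((\<beta> \<circ> \<beta>') x)) (\<beta>' ((\<beta> \<circ> \<beta>') y))"
      by (simp_all add: distribute sort_words)
  next
    fix x y z a b c
    assume x: "x \<in> V a" and y: "y \<in> V b" and z: "z \<in> V c"
    have "mult (\<alpha> (\<alpha>' (\<alpha>' x))) (mult (\<alpha>' (\<beta>' y)) (\<beta>' (\<beta>' z))) =
        mult (mult (\<alpha>' (\<alpha>' x)) (\<alpha>' (\<beta>' y))) (\<beta> (\<beta>' (\<beta>' z)))"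
      by (intro P.bihom_associative[where a = a and b = b and c = c] degree x y z)
    then show "mult (\<alpha>' ((\<alpha> \<circ> \<alpha>') x)) (\<beta>' (mult (\<alpha>' y) (\<beta>' z))) =
        mult (\<alpha>' (mult (\<alpha>' x) (\<beta>' y))) (\<beta>' ((\<beta> \<circ> \<beta>') z))"
      by (simp add: distribute sort_words)
  next
    fix x y a b
    assume x: "x \<in> V a" and y: "y \<in> V b"
    have "bracket (\<beta> (\<alpha>' (\<beta>' x))) (\<alpha> (\<alpha>' (\<beta>' y))) =
        - scale (\<epsilon> a b) (bracket (\<beta> (\<alpha>' (\<beta>' y))) (\<alpha> (\<alpha>' (\<beta>' x))))"
      by (intro P.bihom_skew_symmetric degree x y)
    then show "bracket (\<alpha>' ((\<beta> \<circ> \<beta>') x)) (\<beta>' ((\<alpha> \<circ> \<alpha>') y)) =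
        - scale (\<epsilon> a b) (bracket (\<alpha>' ((\<beta> \<circ> \<beta>') y)) (\<beta>' ((\<alpha> \<circ> \<alpha>') x)))"
      by (simp add: sort_words)
  next
    fix x y z a b c
    assume x: "x \<in> V a" and y: "y \<in> V b" and z: "z \<in> V c"
    let ?w = "\<lambda>u. \<alpha>' (\<beta>' (\<beta>' u))"
    have "scale (\<epsilon> c a) (bracket (\<beta> (\<beta> (?w x))) (bracket (\<beta> (?w y)) (\<alpha> (?w z)))) +
        scale (\<epsilon> a b) (bracket (\<beta> (\<beta> (?w y))) (bracket (\<beta> (?w z)) (\<alpha> (?w x)))) +
        scale (\<epsilon> b c) (bracket (\<beta> (\<beta> (?w z))) (bracket (\<beta> (?w x)) (\<alpha> (?w y)))) = 0"
      by (intro P.bihom_jacobi degree x y z)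
    then show
      "scale (\<epsilon> c a) (bracket (\<alpha>' ((\<beta> \<circ> \<beta>') ((\<beta> \<circ> \<beta>') x)))
          (\<beta>' (bracket (\<alpha>' ((\<beta> \<circ> \<beta>') y)) (\<beta>' ((\<alpha> \<circ> \<alpha>') z))))) +
        scale (\<epsilon> a b) (bracket (\<alpha>' ((\<beta> \<circ> \<beta>') ((\<beta> \<circ> \<beta>') y)))
          (\<beta>' (bracket (\<alpha>' ((\<beta> \<circ> \<beta>') z)) (\<beta>' ((\<alpha> \<circ> \<alpha>') x))))) +
        scale (\<epsilon> b c) (bracket (\<alpha>' ((\<beta> \<circ> \<beta>') ((\<beta> \<circ> \<beta>') z)))
          (\<beta>' (bracket (\<alpha>' ((\<beta> \<circ> \<beta>') x)) (\<beta>' ((\<alpha> \<circ> \<alpha>') y))))) = 0"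
      by (simp add: distribute sort_words)
  next
    fix x y z a b c
    assume x: "x \<in> V a" and y: "y \<in> V b" and z: "z \<in> V c"
    let ?u = "\<alpha>' (\<alpha>' (\<beta>' x))" and ?v = "\<alpha>' (\<beta>' y)" and ?w = "\<beta>' (\<beta>' z)"
    have "bracket (\<alpha> (\<beta> ?u)) (mult ?v ?w) =
        mult (bracket (\<beta> ?u) ?v) (\<beta> ?w) + scale (\<epsilon> a b) (mult (\<beta> ?v) (bracket (\<alpha> ?u) ?w))"
      by (intro P.bihom_leibniz[where a = a and b = b and c = c] degree x y z)
    then show "bracket (\<alpha>' ((\<alpha> \<circ> \<alpha>') ((\<beta> \<circ> \<beta>') x))) (\<beta>' (mult (\<alpha>' y) (\<beta>' z))) =
        mult (\<alpha>' (bracket (\<alpha>' ((\<beta> \<circ> \<beta>') x)) (\<beta>' y))) (\<beta>' ((\<beta> \<circ> \<beta>') z)) +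
        scale (\<epsilon> a b)
          (mult (\<alpha>' ((\<beta> \<circ> \<beta>') y)) (\<beta>' (bracket (\<alpha>' ((\<alpha> \<circ> \<alpha>') x)) (\<beta>' z))))"
      by (simp add: distribute sort_words)
  qed
qed

end
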